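(* Let $(\mathbf d,w)\in\mathbb N^m\times\mathbb R_{>0}^m$ be a normalized pair (i.e. $\sum_{i=1}^m d_i\ge n$ and $\sum_{i=1}^m w_i^2d_i=1$). Let $\mathcal W_w=(w_i,W_i)_{i=1}^m\in\mathcal B_{m,n}(\mathbf d,w)$ be a local minimizer of the fusion frame potential $\mathrm{FFP}$ on $\mathcal B_{m,n}(\mathbf d,w)$ with respect to the distance $d_P$. If $\sigma(S_{\mathcal W_w})=\{\mu_1,\dots,\mu_r\}$, with $\mu_1,\dots,\mu_r$ distinct, then for every $k\in\{1,\dots,r\}$ $$P_{\mu_k}(S_{\mathcal W_w})\in\{P_{W_j}:1\le j\le m\}',$$ i.e. every spectral projection of $S_{\mathcal W_w}$ commutes with every $P_{W_j}$. The same property holds whenever $\mathcal W_w$ is a $d_P$-local minimizer of $\mathrm{FFP}$ in $\mathcal B^1_{m,n}(\mathbf d)$.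
   Context: $P_W$ is the orthogonal projection onto $W$. $\mathcal B_{m,n}(\mathbf d,w)$ is the set of all $\mathcal W_w=(w_i,W_i)_{i=1}^m$ with the fixed weights $w$ and subspaces $W_i\subseteq\mathbb C^n$, $\dim W_i=d_i$. $\mathcal B^1_{m,n}(\mathbf d)$ is the set of all $\mathcal W_w=(w_i,W_i)_{i=1}^m$ with arbitrary weights $w\in\mathbb R_{>0}^m$ satisfying $\sum_i w_i^2d_i=1$ and subspaces $W_i\subseteq\mathbb C^n$, $\dim W_i=d_i$. The frame operator is $S_{\mathcal W_w}=\sum_i w_i^2P_{W_i}$ and $\mathrm{FFP}(\mathcal W_w)=\operatorname{tr}(S_{\mathcal W_w}^2)$. The punctual (pseudo-)distance is $d_P(\mathcal W_w,\mathcal W'_{w'})=\max_{1\le i\le m}\|P_{W_i}-P_{W'_i}\|$ (spectral norm). For Hermitian $S$ and $\mu\in\sigma(S)$, $P_\mu(S)$ is the orthogonal projection onto $N(S-\mu I_n)$. $\{P_{W_j}\}'=\{A\in\mathcal M_n(\mathbb C):AP_{W_j}=P_{W_j}A\ \forall j\}$. *)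

theory Defs
  imports "HOL-Analysis.Analysis"
begin

text \<open>
  The real inner product of \<^typ>\<open>complex^'n\<close> is only the real part of the Hermitian one,
  so orthogonality in \<open>\<complex>\<^sup>n\<close> is expressed through \<open>cinner\<close>. Complex subspaces and complex
  dimension are \<open>vec.subspace\<close> and \<open>vec.dim\<close> (scalar multiplication \<open>*s\<close>), in contrast to
  \<open>subspace\<close> and \<open>dim\<close>, which are over the reals.
\<close>

definition cinner :: "complex^'n \<Rightarrow> complex^'n \<Rightarrow> complex"
  where "cinner x y = (\<Sum>i\<in>UNIV. x $ i * cnj (y $ i))"

definition is_orthproj :: "(complex^'n) set \<Rightarrow> complex^'n^'n \<Rightarrow> bool"
  where "is_orthproj W P \<longleftrightarrow>
    (\<forall>x. P *v x \<in> W \<and> (\<forall>y\<in>W. cinner (x - P *v x) y = 0))"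

text \<open>Only meaningful for a complex subspace \<open>W\<close>; see \<open>is_orthproj_orthproj\<close> below.\<close>

definition orthproj :: "(complex^'n) set \<Rightarrow> complex^'n^'n"
  where "orthproj W = (THE P. is_orthproj W P)"

definition spectral_norm :: "complex^'n^'n \<Rightarrow> real"
  where "spectral_norm A = onorm (\<lambda>x. A *v x)"

definition spectrum :: "complex^'n^'n \<Rightarrow> complex set"
  where "spectrum A = {\<mu>. \<exists>x. x \<noteq> 0 \<and> A *v x = \<mu> *s x}"

definition spectral_proj :: "complex^'n^'n \<Rightarrow> complex \<Rightarrow> complex^'n^'n"
  where "spectral_proj A \<mu> = orthproj {x. (A - mat \<mu>) *v x = 0}"

definition commutant :: "(complex^'n^'n) set \<Rightarrow> (complex^'n^'n) set"
  where "commutant X = {A. \<forall>B\<in>X. A ** B = B ** A}"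

text \<open>A weighted family \<open>(w\<^sub>i, W\<^sub>i)\<close>, indexed by a finite type \<open>'m\<close>, as a pair \<open>(w, W)\<close>.\<close>

type_synonym ('m, 'n) fusion = "('m \<Rightarrow> real) \<times> ('m \<Rightarrow> (complex^'n) set)"

definition normalized_pair :: "nat \<Rightarrow> ('m::finite \<Rightarrow> nat) \<Rightarrow> ('m \<Rightarrow> real) \<Rightarrow> bool"
  where "normalized_pair n d w \<longleftrightarrow>
    (\<forall>i. w i > 0) \<and> (\<Sum>i\<in>UNIV. d i) \<ge> n \<and> (\<Sum>i\<in>UNIV. (w i)\<^sup>2 * real (d i)) = 1"

definition fusion_B :: "('m::finite \<Rightarrow> nat) \<Rightarrow> ('m \<Rightarrow> real) \<Rightarrow> ('m, 'n::finite) fusion set"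
  where "fusion_B d w =
    {(v, W). v = w \<and> (\<forall>i. vec.subspace (W i) \<and> vec.dim (W i) = d i)}"

definition fusion_B1 :: "('m::finite \<Rightarrow> nat) \<Rightarrow> ('m, 'n::finite) fusion set"
  where "fusion_B1 d =
    {(v, W). (\<forall>i. v i > 0) \<and> (\<Sum>i\<in>UNIV. (v i)\<^sup>2 * real (d i)) = 1 \<and>
       (\<forall>i. vec.subspace (W i) \<and> vec.dim (W i) = d i)}"

definition frame_operator :: "('m::finite, 'n::finite) fusion \<Rightarrow> complex^'n^'n"
  where "frame_operator F = (\<Sum>i\<in>UNIV. (fst F i)\<^sup>2 *\<^sub>R orthproj (snd F i))"

text \<open>The trace is real whenever all \<open>snd F i\<close> are subspaces; see \<open>complex_of_real_FFP\<close> below.\<close>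

definition FFP :: "('m::finite, 'n::finite) fusion \<Rightarrow> real"
  where "FFP F = Re (trace (frame_operator F ** frame_operator F))"

text \<open>The weights do not enter, so this is only a pseudo-distance.\<close>

definition dP :: "('m::finite, 'n::finite) fusion \<Rightarrow> ('m, 'n) fusion \<Rightarrow> real"
  where "dP F G = Max (range (\<lambda>i. spectral_norm (orthproj (snd F i) - orthproj (snd G i))))"

definition dP_local_minimizer ::
    "(('m::finite, 'n::finite) fusion \<Rightarrow> real) \<Rightarrow> ('m, 'n) fusion set \<Rightarrow> ('m, 'n) fusion \<Rightarrow> bool"
  where "dP_local_minimizer f A F \<longleftrightarrow>
    F \<in> A \<and> (\<exists>\<epsilon>>0. \<forall>G\<in>A. dP F G < \<epsilon> \<longrightarrow> f F \<le> f G)"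

lemma cinner_add_left: "cinner (x + y) z = cinner x z + cinner y z"
  by (simp add: cinner_def algebra_simps sum.distrib)

lemma cinner_diff_left: "cinner (x - y) z = cinner x z - cinner y z"
  by (simp add: cinner_def algebra_simps sum_subtractf)

lemma cinner_scale_left: "cinner (c *s x) z = c * cinner x z"
  by (simp add: cinner_def algebra_simps sum_distrib_left)

lemma cinner_scale_right: "cinner x (c *s z) = cnj c * cinner x z"
  by (simp add: cinner_def algebra_simps sum_distrib_left)

lemma cinner_commute: "cinner x y = cnj (cinner y x)"
  by (simp add: cinner_def mult.commute)

lemma Re_cinner: "Re (cinner x y) = x \<bullet> y"
  by (simp add: cinner_def inner_vec_def inner_complex_def)

lemma cinner_self_zero: "cinner x x = 0 \<Longrightarrow> x = 0"
  using Re_cinner[of x x] by simp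

lemma vec_subspace_imp_subspace:
  assumes "vec.subspace (W :: (complex^'n) set)"
  shows "subspace W"
proof -
  have "c *\<^sub>R x = complex_of_real c *s x" for c and x :: "complex^'n"
    by (simp add: vec_eq_iff scaleR_conv_of_real[where 'a = complex])
  then show ?thesis
    using assms by (auto simp: subspace_def vec.subspace_def)
qed

lemma orthproj_pointwise_exists:
  assumes W: "vec.subspace (W :: (complex^'n) set)"
  shows "\<exists>p\<in>W. \<forall>y\<in>W. cinner (x - p) y = 0"
proof -
  have sp: "span W = W"
    using vec_subspace_imp_subspace[OF W] by (simp add: span_eq_iff)
  obtain p z where p: "p \<in> W" and z: "\<And>y. y \<in> W \<Longrightarrow> orthogonal z y" and x: "x = p + z"
    using orthogonal_subspace_decomp_exists[of W x] unfolding sp by metis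
  have "cinner (x - p) y = 0" if y: "y \<in> W" for y
  proof -
    have iy: "\<i> *s y \<in> W"
      using W y by (rule vec.subspace_scale)
    have "Re (cinner z y) = 0"
      using z[OF y] by (simp add: Re_cinner orthogonal_def)
    moreover have "Re (cinner z (\<i> *s y)) = 0"
      using z[OF iy] by (simp add: Re_cinner orthogonal_def)
    ultimately show ?thesis
      by (simp add: x cinner_scale_right complex_eq_iff)
  qed
  with p show ?thesis by blast
qed

lemma orthproj_pointwise_unique:
  assumes W: "vec.subspace (W :: (complex^'n) set)"
    and "p \<in> W" "\<And>y. y \<in> W \<Longrightarrow> cinner (x - p) y = 0"
    and "q \<in> W" "\<And>y. y \<in> W \<Longrightarrow> cinner (x - q) y = 0"
  shows "p = q"
proof -
  have m: "p - q \<in> W"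
    using W assms(2,4) by (rule vec.subspace_diff)
  have "cinner (p - q) (p - q) = cinner (x - q) (p - q) - cinner (x - p) (p - q)"
    by (simp flip: cinner_diff_left)
  also have "\<dots> = 0"
    using assms(3)[OF m] assms(5)[OF m] by simp
  finally show ?thesis
    using cinner_self_zero by fastforce
qed

lemma is_orthproj_unique:
  assumes "vec.subspace (W :: (complex^'n) set)" "is_orthproj W P" "is_orthproj W Q"
  shows "P = Q"
proof -
  have "P *v x = Q *v x" for x
    using assms by (intro orthproj_pointwise_unique[of W _ x]) (auto simp: is_orthproj_def)
  then show ?thesis by (simp add: matrix_eq)
qed

lemma is_orthproj_exists:
  assumes W: "vec.subspace (W :: (complex^'n) set)"
  shows "\<exists>P. is_orthproj W P"
proof -
  obtain f where f: "\<And>x. f x \<in> W" "\<And>x y. y \<in> W \<Longrightarrow> cinner (x - f x) y = 0"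
    using orthproj_pointwise_exists[OF W] by metis
  have add: "f (x + y) = f x + f y" for x y
  proof (rule orthproj_pointwise_unique[OF W, of _ "x + y"])
    show "f x + f y \<in> W" using f(1) W by (intro vec.subspace_add)
    show "cinner (x + y - (f x + f y)) z = 0" if "z \<in> W" for z
      using f(2)[OF that, of x] f(2)[OF that, of y]
      by (simp add: cinner_diff_left cinner_add_left)
  qed (use f in auto)
  have scale: "f (c *s x) = c *s f x" for c x
  proof (rule orthproj_pointwise_unique[OF W, of _ "c *s x"])
    show "c *s f x \<in> W" using W f(1) by (rule vec.subspace_scale)
    show "cinner (c *s x - c *s f x) z = 0" if "z \<in> W" for z
      using f(2)[OF that, of x] by (simp add: cinner_diff_left cinner_scale_left)
  qed (use f in auto)
  have "Vector_Spaces.linear (*s) (*s) f"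
    using add scale by unfold_locales auto
  then have "matrix f *v x = f x" for x
    by (rule matrix_works)
  with f show ?thesis
    unfolding is_orthproj_def by metis
qed

lemma is_orthproj_orthproj:
  assumes "vec.subspace (W :: (complex^'n) set)"
  shows "is_orthproj W (orthproj W)"
  unfolding orthproj_def
  using is_orthproj_exists[OF assms] is_orthproj_unique[OF assms] by (metis theI)

lemma orthproj_hermitian:
  assumes W: "vec.subspace (W :: (complex^'n) set)"
  shows "orthproj W $ i $ j = cnj (orthproj W $ j $ i)"
proof -
  define P where "P = orthproj W"
  have P: "P *v x \<in> W" "y \<in> W \<Longrightarrow> cinner (x - P *v x) y = 0" for x y
    using is_orthproj_orthproj[OF W] by (auto simp: is_orthproj_def P_def)
  have 1: "cinner x (P *v y) = cinner (P *v x) (P *v y)" for x y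
    using P(2)[OF P(1), of x y] by (simp add: cinner_diff_left)
  have sym: "cinner x (P *v y) = cinner (P *v x) y" for x y
    using 1[of x y] 1[of y x] by (metis cinner_commute)
  have entry: "P $ k $ l = cinner (P *v axis l 1) (axis k 1)" for k l
    by (simp add: cinner_def axis_def matrix_vector_mult_def if_distrib[of cnj]
          if_distrib[of "(*) _"] sum.delta cong: if_cong)
  show ?thesis
    using sym[of "axis j 1" "axis i 1"] entry[of i j] entry[of j i]
    by (metis P_def cinner_commute)
qed

lemma complex_of_real_FFP:
  assumes "\<And>i. vec.subspace (snd F i)"
  shows "complex_of_real (FFP F) = trace (frame_operator F ** frame_operator F)"
proof -
  define S where "S = frame_operator F"
  have herm: "S $ i $ j = cnj (S $ j $ i)" for i j
    unfolding S_def frame_operator_def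
    by (simp add: sum_component)
       (intro sum.cong refl, metis orthproj_hermitian[OF assms] complex_cnj_scaleR)
  have "cnj (trace (S ** S)) = trace (S ** S)"
  proof -
    have "cnj (trace (S ** S)) = (\<Sum>i\<in>UNIV. \<Sum>k\<in>UNIV. S $ k $ i * S $ i $ k)"
      by (simp add: trace_def matrix_matrix_mult_def) (simp flip: herm)
    then show ?thesis
      by (simp add: trace_def matrix_matrix_mult_def mult.commute)
  qed
  then have "trace (S ** S) \<in> \<real>"
    by (simp add: Reals_cnj_iff)
  then show ?thesis
    by (simp add: FFP_def S_def)
qed

end

theory Submission
  imports Defs
begin

text \<open>
  Write \<open>S\<close> for the frame operator and \<open>P\<^sub>j\<close> for the projection onto \<open>W\<^sub>j\<close>. The point is that at a
  local minimizer \<open>S\<close> leaves every \<open>W\<^sub>j\<close> invariant. Only deformations that keep the weights and move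
  one single subspace are needed, so a minimizer in \<open>fusion_B1\<close> is only compared with families
  that have its own weights, that is, it is treated as a minimizer in \<open>fusion_B\<close>.

  Let \<open>x \<in> W\<^sub>j\<close> and \<open>y \<in> W\<^sub>j\<^sup>\<bottom>\<close> be unit vectors. The reflection in the hyperplane orthogonal to
  \<open>x + t y\<close> maps \<open>W\<^sub>j\<close> to a subspace \<open>W\<^sub>j(t)\<close> of the same dimension, and \<open>W\<^sub>j(0) = W\<^sub>j\<close>. Its
  projection is \<open>P\<^sub>j + D(t)\<close>, where \<open>D(t)\<close> is an explicit combination of the four matrices
  \<open>x x\<^sup>*, y y\<^sup>*, x y\<^sup>*, y x\<^sup>*\<close> (\<open>orthproj_reflected\<close>), and \<open>D(t) = O(t)\<close> (\<open>spectral_norm_displacement_le\<close>).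
  Replacing \<open>W\<^sub>j\<close> by \<open>W\<^sub>j(t)\<close> changes the potential by
  \<open>2 w\<^sub>j\<^sup>2 tr (S D(t)) + w\<^sub>j\<^sup>4 tr (D(t)\<^sup>2) = 8 w\<^sub>j\<^sup>2 t Re \<langle>S x, y\<rangle> + O(t\<^sup>2)\<close>,
  so minimality forces \<open>Re \<langle>S x, y\<rangle> \<ge> 0\<close> (\<open>local_minimizer_Re_cinner_nonneg\<close>). Multiplying \<open>y\<close> by
  \<open>-1\<close> and by \<open>\<plusminus>\<i>\<close> gives \<open>\<langle>S x, y\<rangle> = 0\<close>, that is, \<open>S W\<^sub>j \<subseteq> W\<^sub>j\<close>.

  A Hermitian matrix that leaves a subspace invariant commutes with the projection onto it
  (\<open>hermitian_invariant_commutes\<close>). This is used twice: it shows that \<open>S\<close> commutes with \<open>P\<^sub>j\<close>;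
  hence \<open>P\<^sub>j\<close> leaves each eigenspace of \<open>S\<close> invariant, and so \<open>P\<^sub>j\<close> commutes with the spectral
  projections of \<open>S\<close>.
\<close>

section \<open>The Hermitian inner product\<close>

lemma cinner_scaleR_left: "cinner (r *\<^sub>R x) z = of_real r * cinner x z"
  by (simp add: cinner_def sum_distrib_left scaleR_conv_of_real[where 'a = complex] mult.assoc)

lemma cinner_scaleR_right: "cinner x (r *\<^sub>R z) = of_real r * cinner x z"
  by (simp add: cinner_def sum_distrib_left scaleR_conv_of_real[where 'a = complex] mult_ac)

lemma cinner_add_right: "cinner x (y + z) = cinner x y + cinner x z"
  by (simp add: cinner_def algebra_simps sum.distrib)

lemma cinner_diff_right: "cinner x (y - z) = cinner x y - cinner x z"
  by (simp add: cinner_def algebra_simps sum_subtractf)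

lemma cinner_minus_right: "cinner x (- y) = - cinner x y"
  by (simp add: cinner_def sum_negf)

lemma cinner_zero_left: "cinner 0 x = 0"
  by (simp add: cinner_def)

lemma cinner_zero_right: "cinner x 0 = 0"
  by (simp add: cinner_def)

lemma cinner_sum_left: "cinner (sum f A) z = (\<Sum>i\<in>A. cinner (f i) z)"
  by (induction A rule: infinite_finite_induct) (auto simp: cinner_add_left cinner_zero_left)

lemma cinner_sum_right: "cinner z (sum f A) = (\<Sum>i\<in>A. cinner z (f i))"
  by (induction A rule: infinite_finite_induct) (auto simp: cinner_add_right cinner_zero_right)

lemma cinner_self: "cinner x x = of_real ((norm x)\<^sup>2)"
proof -
  have "cinner x x = (\<Sum>i\<in>UNIV. of_real ((cmod (x $ i))\<^sup>2))"
    unfolding cinner_def by (intro sum.cong refl) (simp only: complex_norm_square)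
  also have "\<dots> = of_real ((norm x)\<^sup>2)"
    by (simp add: norm_vec_def L2_set_def sum_nonneg)
  finally show ?thesis .
qed

lemma norm_scalar_mult: "norm (c *s (x :: complex^'n)) = cmod c * norm x"
proof -
  have "of_real ((norm (c *s x))\<^sup>2) = c * cnj c * cinner x x"
    unfolding cinner_self[symmetric] by (simp add: cinner_scale_left cinner_scale_right)
  also have "\<dots> = of_real ((cmod c * norm x)\<^sup>2)"
    unfolding cinner_self complex_norm_square[symmetric] by (simp add: power_mult_distrib)
  finally have "(norm (c *s x))\<^sup>2 = (cmod c * norm x)\<^sup>2"
    using of_real_eq_iff by blast
  then show ?thesis by (simp add: power2_eq_iff_nonneg)
qed

lemma cinner_Cauchy_Schwarz: "cmod (cinner x y) \<le> norm x * norm y"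
proof (cases "cinner x y = 0")
  case False
  define c where "c = cnj (cinner x y) / of_real (cmod (cinner x y))"
  have c: "cmod c = 1" using False by (simp add: c_def norm_divide)
  have "cinner (c *s x) y = of_real (cmod (cinner x y))"
    using False complex_norm_square[of "cinner x y"]
    by (simp add: cinner_scale_left c_def field_simps power2_eq_square)
  then have "cmod (cinner x y) = (c *s x) \<bullet> y"
    using Re_cinner[of "c *s x" y] by simp
  also have "\<dots> \<le> norm x * norm y"
    using norm_cauchy_schwarz[of "c *s x" y] by (simp add: norm_scalar_mult c)
  finally show ?thesis .
qed simp

section \<open>Hermitian matrices and projections\<close>

text \<open>Self-adjointness, stated through the Hermitian inner product rather than through entries.\<close>

definition hermitian :: "complex^'n^'n \<Rightarrow> bool"
  where "hermitian A \<longleftrightarrow> (\<forall>x y. cinner (A *v x) y = cinner x (A *v y))"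

lemma matrix_vector_scaleR_left: "(r *\<^sub>R A) *v x = r *\<^sub>R (A *v (x :: complex^'n))"
  by (simp add: vec_eq_iff matrix_vector_mult_def scaleR_sum_right)

lemma matrix_vector_scaleR_right: "A *v (r *\<^sub>R x) = r *\<^sub>R (A *v (x :: complex^'n))"
  by (simp add: vec_eq_iff matrix_vector_mult_def scaleR_sum_right)

lemma matrix_vector_sum_left: "sum f I *v x = (\<Sum>i\<in>I. f i *v (x :: complex^'n))"
  by (induction I rule: infinite_finite_induct) (auto simp: matrix_vector_mult_add_rdistrib)

lemma orthproj_in: "vec.subspace W \<Longrightarrow> orthproj W *v x \<in> W"
  using is_orthproj_orthproj[of W] by (auto simp: is_orthproj_def)

lemma orthproj_orth: "vec.subspace W \<Longrightarrow> y \<in> W \<Longrightarrow> cinner (x - orthproj W *v x) y = 0"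
  using is_orthproj_orthproj[of W] by (auto simp: is_orthproj_def)

lemma orthproj_fixes:
  assumes "vec.subspace W" "x \<in> W"
  shows "orthproj W *v x = x"
  using assms orthproj_in[OF assms(1)] orthproj_orth[OF assms(1)]
  by (intro orthproj_pointwise_unique[OF assms(1), of _ x]) (auto simp: cinner_zero_left)

lemma orthproj_kills:
  assumes "vec.subspace W" "\<And>z. z \<in> W \<Longrightarrow> cinner y z = 0"
  shows "orthproj W *v y = 0"
  using assms orthproj_in[OF assms(1)] orthproj_orth[OF assms(1)]
  by (intro orthproj_pointwise_unique[OF assms(1), of _ y])
     (auto intro: vec.subspace_0)

lemma hermitian_orthproj:
  assumes W: "vec.subspace W"
  shows "hermitian (orthproj W)"
proof -
  have "cinner x (orthproj W *v y) = cinner (orthproj W *v x) (orthproj W *v y)" for x y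
    using orthproj_orth[OF W orthproj_in[OF W], of x y] by (simp add: cinner_diff_left)
  then show ?thesis
    unfolding hermitian_def by (metis cinner_commute)
qed

lemma hermitian_invariant_commutes:
  assumes A: "hermitian A" and W: "vec.subspace W" and inv: "\<And>x. x \<in> W \<Longrightarrow> A *v x \<in> W"
  shows "A ** orthproj W = orthproj W ** A"
proof -
  let ?P = "orthproj W"
  have P: "cinner (?P *v x) y = cinner x (?P *v y)" for x y
    using hermitian_orthproj[OF W] by (simp add: hermitian_def)
  have PAP: "?P *v (A *v (?P *v x)) = A *v (?P *v x)" for x
    by (intro orthproj_fixes W inv orthproj_in)
  \<comment> \<open>Both \<open>A P\<close> and \<open>P A\<close> equal \<open>P A P\<close>; the second equality is the adjoint of the first.\<close>
  have "cinner (?P *v (A *v x)) y = cinner (A *v (?P *v x)) y" for x y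
  proof -
    have "cinner (?P *v (A *v x)) y = cinner x (A *v (?P *v y))"
      using A by (simp add: P hermitian_def)
    also have "\<dots> = cinner x (?P *v (A *v (?P *v y)))"
      by (simp add: PAP)
    also have "\<dots> = cinner (?P *v (A *v (?P *v x))) y"
      using A by (simp add: P hermitian_def)
    finally show ?thesis by (simp add: PAP)
  qed
  then have "cinner (?P *v (A *v x) - A *v (?P *v x)) y = 0" for x y
    by (simp add: cinner_diff_left)
  then have "?P *v (A *v x) = A *v (?P *v x)" for x
    using cinner_self_zero[of "?P *v (A *v x) - A *v (?P *v x)"] by simp
  then show ?thesis
    by (simp add: matrix_eq flip: matrix_vector_mul_assoc)
qed

lemma hermitian_frame_operator:
  assumes "\<And>i. vec.subspace (snd F i)"
  shows "hermitian (frame_operator F)"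
  using hermitian_orthproj[OF assms]
  by (simp add: hermitian_def frame_operator_def matrix_vector_sum_left matrix_vector_scaleR_left
      cinner_sum_left cinner_sum_right cinner_scaleR_left cinner_scaleR_right)

lemma spectral_proj_commutes:
  assumes A: "A ** B = B ** A" and B: "hermitian B"
  shows "spectral_proj A \<mu> ** B = B ** spectral_proj A \<mu>"
proof -
  let ?E = "{x. (A - mat \<mu>) *v x = 0}"
  have E: "vec.subspace ?E"
    by (auto simp: vec.subspace_def matrix_vector_right_distrib vec.scale)
  have mem: "x \<in> ?E \<longleftrightarrow> A *v x = \<mu> *s x" for x
  proof -
    have "mat \<mu> *v x = \<mu> *s x"
      by (simp add: vec_eq_iff matrix_vector_mult_def mat_def if_distrib[of "\<lambda>a. a * _"]
          cong: if_cong)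
    then show ?thesis by (simp add: matrix_vector_mult_diff_rdistrib)
  qed
  have "B *v x \<in> ?E" if "x \<in> ?E" for x
    using that A unfolding mem by (metis matrix_vector_mul_assoc vec.scale)
  then show ?thesis
    using hermitian_invariant_commutes[OF B E] by (simp add: spectral_proj_def)
qed

section \<open>Rank-one matrices\<close>

text \<open>The matrix \<open>x y\<^sup>*\<close>, sending \<open>z\<close> to \<open>\<langle>z, y\<rangle> x\<close>.\<close>

definition outer :: "complex^'n \<Rightarrow> complex^'n \<Rightarrow> complex^'n^'n"
  where "outer x y = (\<chi> i j. x $ i * cnj (y $ j))"

lemma outer_apply: "outer x y *v z = cinner z y *s x"
  by (simp add: outer_def vec_eq_iff matrix_vector_mult_def cinner_def sum_distrib_left mult_ac)

lemma trace_mul_outer: "trace (A ** outer x y) = cinner (A *v x) y"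
  by (simp add: outer_def trace_def matrix_matrix_mult_def matrix_vector_mult_def cinner_def
      sum_distrib_right mult.assoc)

lemma trace_scaleR: "trace (r *\<^sub>R (A :: complex^'n^'n)) = r *\<^sub>R trace A"
  by (simp add: trace_def scaleR_sum_right)

lemma matrix_diff_ldistrib: "A ** (B - C) = A ** B - A ** (C :: complex^'n^'n)"
  by (simp add: vec_eq_iff matrix_matrix_mult_def algebra_simps sum_subtractf)

lemma matrix_add_rdistrib: "(A + B) ** C = A ** C + B ** (C :: complex^'n^'n)"
  by (simp add: vec_eq_iff matrix_matrix_mult_def algebra_simps sum.distrib)

lemma matrix_mul_scaleR_right: "A ** (r *\<^sub>R B) = r *\<^sub>R (A ** (B :: complex^'n^'n))"
  by (simp add: vec_eq_iff matrix_matrix_mult_def scaleR_sum_right)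

lemma matrix_mul_scaleR_left: "(r *\<^sub>R A) ** B = r *\<^sub>R (A ** (B :: complex^'n^'n))"
  by (simp add: vec_eq_iff matrix_matrix_mult_def scaleR_sum_right)

section \<open>Reflecting a subspace\<close>

text \<open>
  Reflection in the complex hyperplane orthogonal to \<open>u\<close>; it is the identity for \<open>u = 0\<close>. Being its
  own inverse and its own adjoint, it transports projections by conjugation.
\<close>

definition reflect :: "complex^'n \<Rightarrow> complex^'n \<Rightarrow> complex^'n"
  where "reflect u z = z - (of_real (2 / (norm u)\<^sup>2) * cinner z u) *s u"

lemma linear_reflect: "Vector_Spaces.linear (*s) (*s) (reflect u)"
  by unfold_locales
     (auto simp: reflect_def cinner_add_left cinner_scale_left vec_eq_iff algebra_simps add_divide_distrib)

lemma reflect_reflect: "reflect u (reflect u z) = z"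
proof (cases "u = 0")
  case False
  then have "cinner (reflect u z) u = - cinner z u"
    by (simp add: reflect_def cinner_diff_left cinner_scale_left cinner_self)
  then show ?thesis
    unfolding reflect_def[of u "reflect u z"] by (simp add: reflect_def vec_eq_iff)
qed (simp add: reflect_def)

lemma cinner_reflect: "cinner (reflect u a) b = cinner a (reflect u b)"
  using cinner_commute[of u b]
  by (simp add: reflect_def cinner_diff_left cinner_diff_right cinner_scale_left
      cinner_scale_right)

lemma
  assumes "vec.subspace W"
  shows subspace_reflect_image: "vec.subspace (reflect u ` W)"
    and dim_reflect_image: "vec.dim (reflect u ` W) = vec.dim W"
proof -
  interpret Vector_Spaces.linear "(*s)" "(*s)" "reflect u"
    by (rule linear_reflect)
  show "vec.subspace (reflect u ` W)"
    using assms by (rule subspace_image)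
  have "inj (reflect u)"
    by (metis injI reflect_reflect)
  then show "vec.dim (reflect u ` W) = vec.dim W"
    using vec.dim_image_eq[OF linear_reflect] inj_on_subset by blast
qed

lemma orthproj_reflect_image:
  assumes W: "vec.subspace W"
  shows "orthproj (reflect u ` W) *v z = reflect u (orthproj W *v reflect u z)"
proof (rule orthproj_pointwise_unique[OF subspace_reflect_image[OF W, of u], of _ z])
  show "cinner (z - reflect u (orthproj W *v reflect u z)) y = 0" if y: "y \<in> reflect u ` W" for y
  proof -
    obtain v where v: "v \<in> W" "y = reflect u v" using y by blast
    show ?thesis
      using orthproj_orth[OF W v(1), of "reflect u z"]
      by (simp add: v cinner_diff_left cinner_reflect reflect_reflect)
  qed
qed (use orthproj_in[OF W] orthproj_in[OF subspace_reflect_image[OF W]]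
      orthproj_orth[OF subspace_reflect_image[OF W]] in auto)

text \<open>
  \<open>displacement x y t\<close> is the difference between the projections onto the reflected and onto the
  original subspace, when the mirror is orthogonal to \<open>x + t y\<close>; see \<open>orthproj_reflected\<close>. The
  number \<open>refl_coeff t\<close> is \<open>2 / \<parallel>x + t y\<parallel>\<^sup>2\<close> for orthonormal \<open>x\<close>, \<open>y\<close>.
\<close>

definition refl_coeff :: "real \<Rightarrow> real"
  where "refl_coeff t = 2 / (1 + t\<^sup>2)"

definition displacement :: "complex^'n \<Rightarrow> complex^'n \<Rightarrow> real \<Rightarrow> complex^'n^'n"
  where "displacement x y t =
    (let k = refl_coeff t in
      t *\<^sub>R ((k * k * t) *\<^sub>R (outer y y - outer x x) + (k * (k - 1)) *\<^sub>R (outer x y + outer y x)))"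

lemma refl_coeff_eq: "refl_coeff t * (t * t) = 2 - refl_coeff t"
  by (simp add: refl_coeff_def field_simps power2_eq_square add_nonneg_eq_0_iff)

lemma displacement_apply:
  "displacement x y t *v z =
    (let k = refl_coeff t in
      t *\<^sub>R ((k * k * t) *\<^sub>R (cinner z y *s y - cinner z x *s x)
            + (k * (k - 1)) *\<^sub>R (cinner z y *s x + cinner z x *s y)))"
  by (simp add: displacement_def Let_def matrix_vector_scaleR_left outer_apply
      matrix_vector_mult_add_rdistrib matrix_vector_mult_diff_rdistrib)

lemma orthproj_reflected:
  assumes W: "vec.subspace W" and x: "x \<in> W" "norm x = 1"
    and y: "\<And>z. z \<in> W \<Longrightarrow> cinner y z = 0" "norm y = 1"
  shows "orthproj (reflect (x + t *\<^sub>R y) ` W) = orthproj W + displacement x y t"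
proof -
  define u where "u = x + t *\<^sub>R y"
  let ?P = "orthproj W"
  let ?k = "of_real (refl_coeff t) :: complex"
  let ?t = "of_real t :: complex"
  have yx: "cinner y x = 0" "cinner x y = 0"
    using y(1)[OF x(1)] cinner_commute[of x y] by auto
  have self: "cinner x x = 1" "cinner y y = 1"
    by (simp_all add: cinner_self x y)
  have "of_real ((norm u)\<^sup>2) = (of_real (1 + t\<^sup>2) :: complex)"
    unfolding cinner_self[symmetric]
    by (simp add: u_def cinner_add_left cinner_add_right cinner_scaleR_left cinner_scaleR_right
        self yx power2_eq_square)
  then have "(norm u)\<^sup>2 = 1 + t\<^sup>2"
    using of_real_eq_iff by blast
  then have refl: "reflect u z = z - (?k * cinner z u) *s u" for z
    by (simp add: reflect_def refl_coeff_def)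
  have K: "?k * (?t * ?t) = 2 - ?k"
    using arg_cong[OF refl_coeff_eq[of t], of "of_real :: real \<Rightarrow> complex"] by simp
  have Pu: "?P *v u = x"
    by (simp add: u_def matrix_vector_right_distrib matrix_vector_scaleR_right
        orthproj_fixes[OF W x(1)] orthproj_kills[OF W y(1)])
  have "reflect u (?P *v reflect u z) = ?P *v z + displacement x y t *v z" for z
  proof -
    have zu: "cinner z u = cinner z x + ?t * cinner z y"
      by (simp add: u_def cinner_add_right cinner_scaleR_right)
    have PR: "?P *v reflect u z = ?P *v z - (?k * cinner z u) *s x"
      by (simp add: refl matrix_vector_mult_diff_distrib vec.scale Pu)
    have "cinner (?P *v z) u = cinner z x"
      using hermitian_orthproj[OF W] Pu by (simp add: hermitian_def)
    moreover have "cinner x u = 1"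
      by (simp add: u_def cinner_add_right cinner_scaleR_right self yx)
    ultimately have c: "cinner (?P *v reflect u z) u = cinner z x - ?k * cinner z u"
      by (simp add: PR cinner_diff_left cinner_scale_left)
    have "(reflect u (?P *v reflect u z)) $ i = (?P *v z + displacement x y t *v z) $ i" for i
    proof -
      \<comment> \<open>The \<open>i\<close>-th coordinate as a polynomial identity; its hypothesis is the normalization
        \<open>k (1 + t\<^sup>2) = 2\<close>.\<close>
      have poly: "p - (k * (a + s * b)) * X - (k * (a - k * (a + s * b))) * (X + s * Y)
          = p + s * (k * k * s * (b * Y - a * X) + k * (k - 1) * (b * X + a * Y))"
        if "k * (s * s) = 2 - k" for p k a s b X Y :: complex
        using that by algebra
      show ?thesis
        using poly[OF K, of "(?P *v z) $ i" "cinner z x" "cinner z y" "x $ i" "y $ i"]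
        unfolding refl[of "?P *v reflect u z"] c
        unfolding zu PR displacement_apply Let_def
        by (simp add: u_def scaleR_conv_of_real[where 'a = complex] algebra_simps)
    qed
    then show ?thesis by (simp add: vec_eq_iff)
  qed
  then show ?thesis
    unfolding u_def[symmetric] matrix_eq
    by (simp add: orthproj_reflect_image[OF W] matrix_vector_mult_add_rdistrib)
qed

lemma trace_mul_displacement:
  assumes A: "hermitian A"
  shows "Re (trace (A ** displacement x y t)) =
    (let k = refl_coeff t in
      t * (k * k * t * Re (cinner (A *v y) y - cinner (A *v x) x)
           + 2 * k * (k - 1) * Re (cinner (A *v x) y)))"
proof -
  have "cinner (A *v y) x = cnj (cinner (A *v x) y)"
    using A cinner_commute[of y "A *v x"] by (simp add: hermitian_def)
  then show ?thesis
    by (simp add: displacement_def Let_def matrix_mul_scaleR_right trace_scaleR matrix_add_ldistrib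
        matrix_diff_ldistrib trace_add trace_sub trace_mul_outer algebra_simps)
qed

lemma hermitian_displacement: "hermitian (displacement x y t)"
  unfolding hermitian_def
  using cinner_commute[of x] cinner_commute[of y]
  by (simp add: displacement_apply Let_def cinner_scaleR_left cinner_scaleR_right cinner_add_left
      cinner_add_right cinner_diff_left cinner_diff_right cinner_scale_left cinner_scale_right
      algebra_simps)

lemma spectral_norm_displacement_le:
  fixes x y :: "complex^'n"
  assumes "norm x = 1" "norm y = 1" "t \<ge> 0"
  shows "spectral_norm (displacement x y t) \<le>
    t * (2 * (refl_coeff t)\<^sup>2 * t + 2 * \<bar>refl_coeff t * (refl_coeff t - 1)\<bar>)"
  unfolding spectral_norm_def
proof (rule onorm_le)
  fix z :: "complex^'n"
  let ?k = "refl_coeff t"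
  have a: "norm (cinner z b *s c) \<le> norm z" if "norm b = 1" "norm c = 1" for b c :: "complex^'n"
    using cinner_Cauchy_Schwarz[of z b] that by (simp add: norm_scalar_mult)
  have 1: "norm (cinner z y *s y - cinner z x *s x) \<le> 2 * norm z"
    using norm_triangle_ineq4[of "cinner z y *s y" "cinner z x *s x"]
      a[OF assms(2,2)] a[OF assms(1,1)] by linarith
  have 2: "norm (cinner z y *s x + cinner z x *s y) \<le> 2 * norm z"
    using norm_triangle_ineq[of "cinner z y *s x" "cinner z x *s y"]
      a[OF assms(2,1)] a[OF assms(1,2)] by linarith
  have "norm ((?k * ?k * t) *\<^sub>R (cinner z y *s y - cinner z x *s x)
            + (?k * (?k - 1)) *\<^sub>R (cinner z y *s x + cinner z x *s y))
      \<le> (?k * ?k * t) * (2 * norm z) + \<bar>?k * (?k - 1)\<bar> * (2 * norm z)"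
    using mult_left_mono[OF 1, of "?k * ?k * t"] mult_left_mono[OF 2, of "\<bar>?k * (?k - 1)\<bar>"] assms(3)
    by (intro order_trans[OF norm_triangle_ineq] add_mono) simp_all
  then have "norm (displacement x y t *v z)
      \<le> t * ((?k * ?k * t) * (2 * norm z) + \<bar>?k * (?k - 1)\<bar> * (2 * norm z))"
    using assms(3) by (simp add: displacement_apply Let_def mult_left_mono)
  then show "norm (displacement x y t *v z)
      \<le> t * (2 * ?k\<^sup>2 * t + 2 * \<bar>?k * (?k - 1)\<bar>) * norm z"
    by (simp add: algebra_simps power2_eq_square)
qed

section \<open>The first variation of the fusion frame potential\<close>

lemma frame_operator_replace:
  assumes "orthproj V = orthproj (W j) + D"
  shows "frame_operator (w, W(j := V)) = frame_operator (w, W) + (w j)\<^sup>2 *\<^sub>R D"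
proof -
  have "frame_operator (w, W(j := V)) =
      (\<Sum>i\<in>UNIV. (w i)\<^sup>2 *\<^sub>R orthproj (W i) + (if i = j then (w j)\<^sup>2 *\<^sub>R D else 0))"
    unfolding frame_operator_def using assms
    by (intro sum.cong) (auto simp: scaleR_add_right)
  then show ?thesis
    by (simp add: frame_operator_def sum.distrib)
qed

lemma FFP_replace:
  assumes "orthproj V = orthproj (W j) + D"
  shows "FFP (w, W(j := V)) = FFP (w, W) + 2 * (w j)\<^sup>2 * Re (trace (frame_operator (w, W) ** D))
           + (w j)^4 * Re (trace (D ** D))"
  unfolding FFP_def frame_operator_replace[of V W j D w, OF assms]
  using trace_mul_sym[of D "frame_operator (w, W)"]
  by (simp add: matrix_add_ldistrib matrix_add_rdistrib trace_add matrix_mul_scaleR_left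
      matrix_mul_scaleR_right trace_scaleR power4_eq_xxxx power2_eq_square algebra_simps)

lemma dP_replace_le:
  fixes W :: "'m::finite \<Rightarrow> (complex^'n) set"
  assumes "orthproj V = orthproj (W j) + D" "spectral_norm D \<le> b"
  shows "dP (w, W) (w, W(j := V)) \<le> b"
proof -
  have neg: "spectral_norm (- A) = spectral_norm A" for A :: "complex^'n^'n"
  proof -
    have "(\<lambda>x. (- A) *v x) = (\<lambda>x. - (A *v x))"
      using matrix_vector_mult_diff_rdistrib[of 0 A] by auto
    then show ?thesis unfolding spectral_norm_def by (simp add: onorm_neg)
  qed
  have zero: "spectral_norm (0 :: complex^'n^'n) = 0"
    by (simp add: spectral_norm_def onorm_zero)
  have "linear ((*v) D)" by simp
  then have "0 \<le> spectral_norm D"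
    unfolding spectral_norm_def by (intro onorm_pos_le linear_conv_bounded_linear[THEN iffD1])
  then have "spectral_norm (orthproj (W i) - orthproj ((W(j := V)) i)) \<le> b" for i
    using assms zero by (auto simp: neg)
  then show ?thesis
    unfolding dP_def by auto
qed

text \<open>
  Complex scalar multiples of \<open>y\<close> satisfy the same hypotheses up to normalization, so this one-sided
  inequality is all that is used of minimality.
\<close>

lemma local_minimizer_Re_cinner_nonneg:
  fixes W :: "'m::finite \<Rightarrow> (complex^'n) set"
  assumes min: "dP_local_minimizer FFP (fusion_B d w) (w, W)" and w: "w j > 0"
    and x: "x \<in> W j" "norm x = 1" and y: "\<And>z. z \<in> W j \<Longrightarrow> cinner y z = 0" "norm y = 1"
  shows "Re (cinner (frame_operator (w, W) *v x) y) \<ge> 0"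
proof (rule ccontr)
  let ?S = "frame_operator (w, W)"
  let ?D = "displacement x y"
  let ?k = refl_coeff
  define \<beta> where "\<beta> = Re (cinner (?S *v x) y)"
  define a where "a = Re (cinner (?S *v y) y - cinner (?S *v x) x)"
  assume "\<not> ?thesis"
  then have \<beta>: "\<beta> < 0" by (simp add: \<beta>_def)
  from min obtain \<epsilon> where \<epsilon>: "\<epsilon> > 0"
    and le: "\<And>G. G \<in> fusion_B d w \<Longrightarrow> dP (w, W) G < \<epsilon> \<Longrightarrow> FFP (w, W) \<le> FFP G"
    and W: "\<And>i. vec.subspace (W i)" "\<And>i. vec.dim (W i) = d i"
    by (auto simp: dP_local_minimizer_def fusion_B_def)
  have yx: "cinner y x = 0" "cinner x y = 0"
    using y(1)[OF x(1)] cinner_commute[of x y] by auto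
  have self: "cinner x x = 1" "cinner y y = 1"
    by (simp_all add: cinner_self x y)
  \<comment> \<open>\<open>g t\<close> is the increment of the potential divided by \<open>t\<close>; it tends to \<open>8 w\<^sub>j\<^sup>2 \<beta> < 0\<close>.\<close>
  define g where "g t = 2 * (w j)\<^sup>2 * (?k t * ?k t * t * a + 2 * ?k t * (?k t - 1) * \<beta>)
      + (w j)^4 * t * (2 * (?k t * ?k t * t)\<^sup>2 + 2 * (?k t * (?k t - 1))\<^sup>2)" for t
  have change: "FFP (w, W(j := reflect (x + t *\<^sub>R y) ` W j)) = FFP (w, W) + t * g t" for t
  proof -
    have SD: "Re (trace (?S ** ?D t)) = t * (?k t * ?k t * t * a + 2 * ?k t * (?k t - 1) * \<beta>)"
      using trace_mul_displacement[OF hermitian_frame_operator[of "(w, W)"], of x y t] W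
      by (simp add: a_def \<beta>_def Let_def)
    have "cinner (?D t *v y) y = of_real (t * (?k t * ?k t * t))"
      "cinner (?D t *v x) x = of_real (- t * (?k t * ?k t * t))"
      "cinner (?D t *v x) y = of_real (t * (?k t * (?k t - 1)))"
      by (simp_all add: displacement_apply Let_def cinner_scaleR_left cinner_add_left
          cinner_diff_left cinner_scale_left yx self cinner_zero_left)
    then have "Re (cinner (?D t *v y) y - cinner (?D t *v x) x) = 2 * (t * (?k t * ?k t * t))"
      "Re (cinner (?D t *v x) y) = t * (?k t * (?k t - 1))"
      by simp_all
    then have DD: "Re (trace (?D t ** ?D t)) =
        t * t * (2 * (?k t * ?k t * t)\<^sup>2 + 2 * (?k t * (?k t - 1))\<^sup>2)"
      unfolding trace_mul_displacement[OF hermitian_displacement]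
      by (simp only: Let_def) (simp add: power2_eq_square algebra_simps)
    show ?thesis
      using FFP_replace[of _ W j _ w, OF orthproj_reflected[OF W(1) x y, of t]]
      unfolding SD DD g_def by (simp add: algebra_simps)
  qed
  have k: "(?k \<longlongrightarrow> 2) (at_right 0)"
    unfolding refl_coeff_def by (auto intro!: tendsto_eq_intros)
  have "(g \<longlongrightarrow> 8 * (w j)\<^sup>2 * \<beta>) (at_right 0)"
    unfolding g_def by (rule tendsto_eq_intros k refl | simp)+
  moreover have "8 * (w j)\<^sup>2 * \<beta> < 0"
    using w \<beta> by (simp add: mult_pos_neg)
  ultimately have ev1: "eventually (\<lambda>t. g t < 0) (at_right 0)"
    by (rule order_tendstoD)
  have "((\<lambda>t. t * (2 * (?k t)\<^sup>2 * t + 2 * \<bar>?k t * (?k t - 1)\<bar>)) \<longlongrightarrow> 0) (at_right 0)"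
    by (rule tendsto_eq_intros k refl | simp)+
  then have ev2: "eventually (\<lambda>t. t * (2 * (?k t)\<^sup>2 * t + 2 * \<bar>?k t * (?k t - 1)\<bar>) < \<epsilon>) (at_right 0)"
    using \<epsilon> by (rule order_tendstoD)
  have "eventually (\<lambda>t. t > 0) (at_right (0::real))"
    by (simp add: eventually_at_right_less)
  with ev1 ev2 have "eventually (\<lambda>t. t > 0 \<and> g t < 0 \<and>
      t * (2 * (?k t)\<^sup>2 * t + 2 * \<bar>?k t * (?k t - 1)\<bar>) < \<epsilon>) (at_right 0)"
    by eventually_elim simp
  then obtain t where t: "t > 0" "g t < 0"
    "t * (2 * (?k t)\<^sup>2 * t + 2 * \<bar>?k t * (?k t - 1)\<bar>) < \<epsilon>"
    using eventually_happens'[OF trivial_limit_at_right_real] by blast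
  let ?G = "(w, W(j := reflect (x + t *\<^sub>R y) ` W j))"
  have "dP (w, W) ?G < \<epsilon>"
    using dP_replace_le[of _ W j, OF orthproj_reflected[OF W(1) x y, of t]
        spectral_norm_displacement_le[OF x(2) y(2)], of w] t by simp
  moreover have "?G \<in> fusion_B d w"
    using W subspace_reflect_image[OF W(1)] dim_reflect_image[OF W(1)]
    by (auto simp: fusion_B_def)
  ultimately have "FFP (w, W) \<le> FFP (w, W) + t * g t"
    using le[of ?G] by (simp add: change)
  moreover have "t * g t < 0"
    using t by (simp add: mult_pos_neg)
  ultimately show False by simp
qed

lemma local_minimizer_frame_operator_commutes:
  fixes W :: "'m::finite \<Rightarrow> (complex^'n) set"
  assumes min: "dP_local_minimizer FFP (fusion_B d w) (w, W)" and w: "w j > 0"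
  shows "frame_operator (w, W) ** orthproj (W j) = orthproj (W j) ** frame_operator (w, W)"
proof -
  let ?S = "frame_operator (w, W)"
  let ?P = "orthproj (W j)"
  have W: "vec.subspace (W i)" for i
    using min by (auto simp: dP_local_minimizer_def fusion_B_def)
  have nonneg: "Re (cinner (?S *v x) y) \<ge> 0"
    if x: "x \<in> W j" and y: "\<And>z. z \<in> W j \<Longrightarrow> cinner y z = 0" for x y
  proof (cases "x = 0 \<or> y = 0")
    case False
    let ?x = "inverse (norm x) *\<^sub>R x" and ?y = "inverse (norm y) *\<^sub>R y"
    have scale: "Re (cinner (?S *v (a *\<^sub>R x)) (b *\<^sub>R y)) = a * b * Re (cinner (?S *v x) y)" for a b
      by (simp add: matrix_vector_scaleR_right cinner_scaleR_left cinner_scaleR_right)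
    have "0 \<le> Re (cinner (?S *v ?x) ?y)"
      using False x y vec_subspace_imp_subspace[OF W]
      by (intro local_minimizer_Re_cinner_nonneg[OF min w])
         (auto simp: cinner_scaleR_left subspace_scale)
    also have "\<dots> = inverse (norm x) * inverse (norm y) * Re (cinner (?S *v x) y)"
      by (rule scale)
    finally show ?thesis
      using False by (auto simp: zero_le_mult_iff mult_le_0_iff)
  qed (auto simp: cinner_zero_left cinner_zero_right)
  have zero: "cinner (?S *v x) y = 0"
    if x: "x \<in> W j" and y: "\<And>z. z \<in> W j \<Longrightarrow> cinner y z = 0" for x y
  proof -
    have "cinner (c *s y) z = 0" if "z \<in> W j" for c z
      using y[OF that] by (simp add: cinner_scale_left)
    then have "Re (cinner (?S *v x) (c *s y)) \<ge> 0" for c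
      using nonneg[OF x] by blast
    from this[of 1] this[of "-1"] this[of \<i>] this[of "-\<i>"] show ?thesis
      by (simp add: cinner_scale_right cinner_minus_right complex_eq_iff)
  qed
  have "?S *v x \<in> W j" if x: "x \<in> W j" for x
  proof -
    let ?y = "?S *v x - ?P *v (?S *v x)"
    have "cinner ?y ?y = cinner (?S *v x) ?y - cinner (?P *v (?S *v x)) ?y"
      by (simp add: cinner_diff_left)
    moreover have "cinner (?S *v x) ?y = 0"
      by (rule zero[OF x orthproj_orth[OF W]])
    moreover have "cinner (?P *v (?S *v x)) ?y = 0"
      using orthproj_orth[OF W orthproj_in[OF W]] cinner_commute complex_cnj_zero by metis
    ultimately have "?y = 0"
      by (intro cinner_self_zero) simp
    then show ?thesis
      using orthproj_in[OF W, of j "?S *v x"] by simp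
  qed
  then show ?thesis
    using hermitian_invariant_commutes[OF hermitian_frame_operator W, of "(w, W)" j] W by simp
qed

lemma local_minimizer_spectral_proj_in_commutant:
  assumes min: "dP_local_minimizer FFP (fusion_B d w) F" and w: "\<And>i. w i > 0"
  shows "spectral_proj (frame_operator F) \<mu> \<in> commutant {orthproj (snd F j) |j. True}"
proof -
  obtain W where F: "F = (w, W)" and W: "\<And>i. vec.subspace (W i)"
    using min by (auto simp: dP_local_minimizer_def fusion_B_def)
  show ?thesis
    using spectral_proj_commutes[OF local_minimizer_frame_operator_commutes[OF min[unfolded F] w]
        hermitian_orthproj[OF W]]
    by (auto simp: F commutant_def)
qed

lemma local_minimizer_fusion_B1_imp_fusion_B:
  assumes "dP_local_minimizer f (fusion_B1 d) F"
  shows "dP_local_minimizer f (fusion_B d (fst F)) F"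
proof -
  have F: "F \<in> fusion_B1 d"
    using assms by (simp add: dP_local_minimizer_def)
  have "fusion_B d (fst F) \<subseteq> fusion_B1 d" "F \<in> fusion_B d (fst F)"
    using F by (auto simp: fusion_B_def fusion_B1_def)
  then show ?thesis
    using assms unfolding dP_local_minimizer_def by blast
qed

theorem theorem4p2p5:
  fixes d :: "'m::finite \<Rightarrow> nat" and w :: "'m \<Rightarrow> real"
  assumes "normalized_pair CARD('n::finite) d w"
  shows
    "(\<forall>F r \<mu>. dP_local_minimizer FFP (fusion_B d w :: ('m, 'n) fusion set) F \<longrightarrow>
        spectrum (frame_operator F) = \<mu> ` {1..r::nat} \<longrightarrow> inj_on \<mu> {1..r} \<longrightarrow>
        (\<forall>k\<in>{1..r}. spectral_proj (frame_operator F) (\<mu> k)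
                       \<in> commutant {orthproj (snd F j) |j. True})) \<and>
     (\<forall>F r \<mu>. dP_local_minimizer FFP (fusion_B1 d :: ('m, 'n) fusion set) F \<longrightarrow>
        spectrum (frame_operator F) = \<mu> ` {1..r::nat} \<longrightarrow> inj_on \<mu> {1..r} \<longrightarrow>
        (\<forall>k\<in>{1..r}. spectral_proj (frame_operator F) (\<mu> k)
                       \<in> commutant {orthproj (snd F j) |j. True}))"
proof (intro conjI allI impI ballI)
  fix F :: "('m, 'n) fusion" and \<mu> :: "nat \<Rightarrow> complex" and k
  assume "dP_local_minimizer FFP (fusion_B d w) F"
  then show "spectral_proj (frame_operator F) (\<mu> k) \<in> commutant {orthproj (snd F j) |j. True}"
    using assms by (intro local_minimizer_spectral_proj_in_commutant)
      (auto simp: normalized_pair_def)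
next
  fix F :: "('m, 'n) fusion" and \<mu> :: "nat \<Rightarrow> complex" and k
  assume min: "dP_local_minimizer FFP (fusion_B1 d) F"
  then have "fst F i > 0" for i
    by (auto simp: dP_local_minimizer_def fusion_B1_def)
  then show "spectral_proj (frame_operator F) (\<mu> k) \<in> commutant {orthproj (snd F j) |j. True}"
    using local_minimizer_fusion_B1_imp_fusion_B[OF min]
    by (intro local_minimizer_spectral_proj_in_commutant) auto
qed

end
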